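(* Let $n\ge1$, let $S_1,S_2\subset\mathbb R^n$ be arbitrary convex bodies, and let $S_0=\langle S_1\cup S_2\rangle$ be the convex hull of their union. Then $$R^n(S_0,S_1,S_2)=0,$$ where $$R^n(x_0,x_1,x_2)=(2^n-2)x_0^n+Q^n_2(x_1,2x_2)-Q^n_2(2x_0,x_1)-Q^n_2(x_0,2x_2),\qquad Q^n_2(x,y)=\sum_{i=1}^{n-1}x^iy^{n-i}.$$
   Context: A convex body is a nonempty compact convex set. The mixed volume of convex bodies $A_1,\dots,A_n\subset\mathbb R^n$ is $$A_1A_2\cdots A_n=\frac1{n!}\sum_{\emptyset\ne I\subset\{1,\dots,n\}}(-1)^{n-|I|}\operatorname{Vol}_n\Big(\sum_{i\in I}A_i\Big),$$ where $\operatorname{Vol}_n$ is the usual volume and sums of bodies are Minkowski sums; so $A^n=\operatorname{Vol}_n(A)$. For a homogeneous polynomial $T(x_0,x_1,x_2)$ of degree $n$, the number $T(S_0,S_1,S_2)$ is obtained by replacing each monomial $x_{i_1}\cdots x_{i_n}$ of $T$ by the mixed volume $S_{i_1}\cdots S_{i_n}$, extended linearly. *)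

theory Defs
  imports "HOL-Analysis.Analysis" "HOL-Library.Set_Algebras" "HOL-Library.Poly_Mapping"
begin

definition convex_body :: "(real ^ 'n) set \<Rightarrow> bool" where
  "convex_body S \<longleftrightarrow> S \<noteq> {} \<and> compact S \<and> convex S"

text \<open>
  The mixed volume of \<open>n\<close> bodies, where \<open>n\<close> is the dimension of the space; it is
  meant for lists of length \<open>n\<close>. The inner sum over \<open>I\<close> is the Minkowski sum of
  sets from \<^theory>\<open>HOL-Library.Set_Algebras\<close>.
\<close>

definition mixed_volume :: "(real ^ 'n) set list \<Rightarrow> real" where
  "mixed_volume As =
     1 / fact CARD('n) *
       (\<Sum>I \<in> Pow {..<CARD('n)} - {{}}.
          (-1) ^ (CARD('n) - card I) * measure lebesgue (\<Sum>i\<in>I. As ! i))"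

text \<open>
  Real polynomials in three variables: finitely supported maps from exponent vectors
  to coefficients, multiplied by convolution.
\<close>

datatype var = X0 | X1 | X2

type_synonym poly3 = "(var \<Rightarrow>\<^sub>0 nat) \<Rightarrow>\<^sub>0 real"

definition Var :: "var \<Rightarrow> poly3" where
  "Var v = Poly_Mapping.single (Poly_Mapping.single v 1) 1"

text \<open>
  \<open>T(S\<^sub>0, S\<^sub>1, S\<^sub>2)\<close> for a polynomial \<open>T\<close> that is homogeneous of degree
  \<open>CARD('n)\<close>: every monomial is replaced by the mixed volume in which each body is
  repeated according to its exponent.
\<close>

definition mixed_eval ::
  "poly3 \<Rightarrow> (real ^ 'n) set \<Rightarrow> (real ^ 'n) set \<Rightarrow> (real ^ 'n) set \<Rightarrow> real" where
  "mixed_eval T S0 S1 S2 =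
     (\<Sum>m \<in> Poly_Mapping.keys T. Poly_Mapping.lookup T m *
        mixed_volume (replicate (Poly_Mapping.lookup m X0) S0 @
                      replicate (Poly_Mapping.lookup m X1) S1 @
                      replicate (Poly_Mapping.lookup m X2) S2))"

definition Q2 :: "nat \<Rightarrow> poly3 \<Rightarrow> poly3 \<Rightarrow> poly3" where
  "Q2 n x y = (\<Sum>i = 1..n - 1. x ^ i * y ^ (n - i))"

definition R :: "nat \<Rightarrow> poly3" where
  "R n = (let x0 = Var X0; x1 = Var X1; x2 = Var X2 in
     (2 ^ n - 2) * x0 ^ n + Q2 n x1 (2 * x2) - Q2 n (2 * x0) x1 - Q2 n x0 (2 * x2))"

end

theory Submission
  imports Defs "HOL-Combinatorics.Permutations"
begin

text \<open>
  For \<open>a, b \<ge> 0\<close> and \<open>C = conv (A \<union> B)\<close>, put \<open>D \<alpha> = \<alpha> A + (a + b - \<alpha>) B\<close>. Then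
  \<open>a A + b C\<close> is the union of the \<open>D \<alpha>\<close> over \<open>\<alpha> \<ge> a\<close>, \<open>a C + b B\<close> the union over \<open>\<alpha> \<le> a\<close>,
  \<open>a C + b C\<close> the union over all \<open>\<alpha> \<in> [0, a + b]\<close>; and by convexity the first two unions
  meet only in \<open>D a = a A + b B\<close>. Hence
  \<open>Vol (a C + b C) + Vol (a A + b B) = Vol (a A + b C) + Vol (a C + b B)\<close>.
  A mixed volume of \<open>k\<close> copies of one body and \<open>n - k\<close> copies of another is a linear combination
  of such volumes, so \<open>S\<^sub>0\<^sup>n + S\<^sub>1\<^sup>k S\<^sub>2\<^sup>n\<^sup>-\<^sup>k = S\<^sub>1\<^sup>k S\<^sub>0\<^sup>n\<^sup>-\<^sup>k + S\<^sub>0\<^sup>k S\<^sub>2\<^sup>n\<^sup>-\<^sup>k\<close>.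
  Weighting this with \<open>2\<^sup>n\<^sup>-\<^sup>k\<close> and summing over \<open>0 < k < n\<close> gives \<open>R\<^sup>n(S\<^sub>0, S\<^sub>1, S\<^sub>2) = 0\<close>.
\<close>

section \<open>Minkowski combinations with the convex hull of a union\<close>

lemma set_plus_UN_distrib: "A + (\<Union>i\<in>I. B i) = (\<Union>i\<in>I. A + B i)"
  unfolding set_plus_def by blast

text \<open>By convexity, a x + b y is (a + b) times a weighted mean of x and y that lies in
  \<open>A\<close>.\<close>

lemma convex_scaleR_plus:
  fixes A :: "'a::real_vector set"
  assumes "convex A" "a \<ge> 0" "b \<ge> 0"
  shows "(*\<^sub>R) a ` A + (*\<^sub>R) b ` A = (*\<^sub>R) (a + b) ` A"
proof (intro equalityI subsetI)
  fix z assume "z \<in> (*\<^sub>R) a ` A + (*\<^sub>R) b ` A"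
  then obtain x y where xy: "x \<in> A" "y \<in> A" and z: "z = a *\<^sub>R x + b *\<^sub>R y"
    by (auto elim!: set_plus_elim)
  show "z \<in> (*\<^sub>R) (a + b) ` A"
  proof (cases "a + b = 0")
    case True
    then have "a = 0" "b = 0" using assms by auto
    then show ?thesis using xy z by force
  next
    case False
    then have ab: "a + b > 0" using assms by simp
    let ?w = "(a / (a + b)) *\<^sub>R x + (b / (a + b)) *\<^sub>R y"
    have "a / (a + b) + b / (a + b) = 1"
      using ab by (simp flip: add_divide_distrib)
    then have "?w \<in> A"
      using assms ab xy by (intro convexD) auto
    moreover have "z = (a + b) *\<^sub>R ?w"
      using ab by (simp add: z scaleR_right_distrib)
    ultimately show ?thesis by blast
  qed
next
  fix z assume "z \<in> (*\<^sub>R) (a + b) ` A"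
  then show "z \<in> (*\<^sub>R) a ` A + (*\<^sub>R) b ` A"
    by (auto simp: scaleR_left_distrib)
qed

text \<open>Each summand raises the factor by 1 through \<open>convex_scaleR_plus\<close>. Since
  \<open>A\<close> is nonempty, its dilate by 0 is {0}, the empty Minkowski sum.\<close>

lemma sum_const_convex:
  fixes A :: "'a::real_vector set"
  assumes "finite J" "convex A" "A \<noteq> {}"
  shows "(\<Sum>i\<in>J. A) = (*\<^sub>R) (real (card J)) ` A"
  using assms(1)
proof (induction J rule: finite_induct)
  case empty
  then show ?case using assms(3) by (auto simp: set_zero)
next
  case (insert j J)
  then show ?case
    using convex_scaleR_plus[OF assms(2), of 1 "real (card J)"] by simp
qed

text \<open>A point of the hull is u s + v t with u + v = 1. After scaling by b the parameter is
  \<alpha> = b u, the share of the total weight b that falls on \<open>A\<close>.\<close>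

lemma scaleR_convex_hull_Un:
  fixes A B :: "'a::euclidean_space set"
  assumes "convex A" "A \<noteq> {}" "convex B" "B \<noteq> {}" "b \<ge> 0"
  shows "(*\<^sub>R) b ` (convex hull (A \<union> B)) = (\<Union>\<alpha>\<in>{0..b}. (*\<^sub>R) \<alpha> ` A + (*\<^sub>R) (b - \<alpha>) ` B)"
proof (intro equalityI subsetI)
  fix z assume "z \<in> (*\<^sub>R) b ` (convex hull (A \<union> B))"
  then obtain u v s t where uv: "u \<ge> 0" "v \<ge> 0" "u + v = 1" and st: "s \<in> A" "t \<in> B"
    and z: "z = b *\<^sub>R (u *\<^sub>R s + v *\<^sub>R t)"
    by (auto simp: convex_hull_union_two[OF assms(1-4)])
  have "b * v = b - b * u" using uv by (simp add: eq_diff_eq flip: distrib_left)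
  then have "z = (b * u) *\<^sub>R s + (b - b * u) *\<^sub>R t"
    using z by (simp add: scaleR_right_distrib)
  moreover have "b * u \<in> {0..b}"
    using uv assms(5) by (auto intro: mult_left_le)
  ultimately show "z \<in> (\<Union>\<alpha>\<in>{0..b}. (*\<^sub>R) \<alpha> ` A + (*\<^sub>R) (b - \<alpha>) ` B)"
    using st by blast
next
  fix z assume "z \<in> (\<Union>\<alpha>\<in>{0..b}. (*\<^sub>R) \<alpha> ` A + (*\<^sub>R) (b - \<alpha>) ` B)"
  then obtain \<alpha> s t where \<alpha>: "0 \<le> \<alpha>" "\<alpha> \<le> b" and st: "s \<in> A" "t \<in> B"
    and z: "z = \<alpha> *\<^sub>R s + (b - \<alpha>) *\<^sub>R t"
    by (auto elim!: set_plus_elim)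
  let ?H = "convex hull (A \<union> B)"
  have "s \<in> ?H" "t \<in> ?H" using st by (simp_all add: hull_inc)
  then have "z \<in> (*\<^sub>R) \<alpha> ` ?H + (*\<^sub>R) (b - \<alpha>) ` ?H" unfolding z by blast
  then show "z \<in> (*\<^sub>R) b ` ?H"
    using convex_scaleR_plus[of ?H \<alpha> "b - \<alpha>"] \<alpha> by simp
qed

lemma
  fixes A B :: "'a::euclidean_space set"
  assumes "convex A" "A \<noteq> {}" "convex B" "B \<noteq> {}" "a \<ge> 0" "b \<ge> 0"
  defines "C \<equiv> convex hull (A \<union> B)"
  shows scaleR_hull_Un_union:
      "((*\<^sub>R) a ` A + (*\<^sub>R) b ` C) \<union> ((*\<^sub>R) a ` C + (*\<^sub>R) b ` B) = (*\<^sub>R) a ` C + (*\<^sub>R) b ` C"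
    and scaleR_hull_Un_inter:
      "((*\<^sub>R) a ` A + (*\<^sub>R) b ` C) \<inter> ((*\<^sub>R) a ` C + (*\<^sub>R) b ` B) = (*\<^sub>R) a ` A + (*\<^sub>R) b ` B"
proof -
  define D where "D \<alpha> = (*\<^sub>R) \<alpha> ` A + (*\<^sub>R) (a + b - \<alpha>) ` B" for \<alpha>
  note hull = scaleR_convex_hull_Un[OF assms(1-4), folded C_def]
  \<comment> \<open>Splitting b C with parameter \<beta> adds \<beta> to the weight a already on
    \<open>A\<close>, so \<alpha> = a + \<beta>.\<close>
  have upper: "(*\<^sub>R) a ` A + (*\<^sub>R) b ` C = (\<Union>\<alpha>\<in>{a..a + b}. D \<alpha>)"
  proof -
    have "(*\<^sub>R) a ` A + (*\<^sub>R) b ` C = (\<Union>\<beta>\<in>{0..b}. (*\<^sub>R) a ` A + ((*\<^sub>R) \<beta> ` A + (*\<^sub>R) (b - \<beta>) ` B))"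
      unfolding hull[OF assms(6)] by (rule set_plus_UN_distrib)
    also have "\<dots> = (\<Union>\<beta>\<in>{0..b}. D (a + \<beta>))"
      using assms by (intro SUP_cong) (simp_all add: D_def convex_scaleR_plus flip: add.assoc)
    also have "\<dots> = (\<Union>\<alpha>\<in>(+) a ` {0..b}. D \<alpha>)"
      by (simp only: image_image)
    also have "(+) a ` {0..b} = {a..a + b}" by (simp add: add.commute)
    finally show ?thesis .
  qed
  have lower: "(*\<^sub>R) a ` C + (*\<^sub>R) b ` B = (\<Union>\<alpha>\<in>{0..a}. D \<alpha>)"
  proof -
    have "(*\<^sub>R) a ` C + (*\<^sub>R) b ` B = (\<Union>\<alpha>\<in>{0..a}. (*\<^sub>R) b ` B + ((*\<^sub>R) \<alpha> ` A + (*\<^sub>R) (a - \<alpha>) ` B))"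
      unfolding hull[OF assms(5)] by (subst add.commute) (rule set_plus_UN_distrib)
    also have "\<dots> = (\<Union>\<alpha>\<in>{0..a}. D \<alpha>)"
    proof (rule SUP_cong[OF refl])
      fix \<alpha> assume "\<alpha> \<in> {0..a}"
      then have "(*\<^sub>R) b ` B + (*\<^sub>R) (a - \<alpha>) ` B = (*\<^sub>R) (a + b - \<alpha>) ` B"
        using convex_scaleR_plus[OF assms(3), of b "a - \<alpha>"] assms(6) by (simp add: algebra_simps)
      then show "(*\<^sub>R) b ` B + ((*\<^sub>R) \<alpha> ` A + (*\<^sub>R) (a - \<alpha>) ` B) = D \<alpha>"
        by (simp add: D_def add.left_commute)
    qed
    finally show ?thesis .
  qed
  have full: "(*\<^sub>R) a ` C + (*\<^sub>R) b ` C = (\<Union>\<alpha>\<in>{0..a + b}. D \<alpha>)"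
    using assms hull[of "a + b"] by (simp add: convex_scaleR_plus D_def)
  have "{a..a + b} \<union> {0..a} = {0..a + b}" using assms by auto
  then show "((*\<^sub>R) a ` A + (*\<^sub>R) b ` C) \<union> ((*\<^sub>R) a ` C + (*\<^sub>R) b ` B) = (*\<^sub>R) a ` C + (*\<^sub>R) b ` C"
    unfolding upper lower full by blast
  \<comment> \<open>(1 - \<theta>) D \<beta> + \<theta> D \<alpha> is contained in the
    \<open>D\<close> of the interpolated parameter. Choosing \<theta> so that this parameter is a,
    and writing x = (1 - \<theta>) x + \<theta> x, puts a common point x into
    \<open>D a\<close>.\<close>
  have "D \<alpha> \<inter> D \<beta> \<subseteq> D a" if \<alpha>: "a \<le> \<alpha>" "\<alpha> \<le> a + b" and \<beta>: "0 \<le> \<beta>" "\<beta> \<le> a" for \<alpha> \<beta>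
  proof
    fix x assume x: "x \<in> D \<alpha> \<inter> D \<beta>"
    have "a \<in> closed_segment \<beta> \<alpha>"
      using \<alpha> \<beta> by (simp add: closed_segment_eq_real_ivl)
    then obtain \<theta> where \<theta>: "0 \<le> \<theta>" "\<theta> \<le> 1" and a: "a = (1 - \<theta>) * \<beta> + \<theta> * \<alpha>"
      by (auto simp: in_segment)
    from x obtain s t s' t' where st: "s \<in> A" "t \<in> B" "s' \<in> A" "t' \<in> B"
      and x1: "x = \<alpha> *\<^sub>R s + (a + b - \<alpha>) *\<^sub>R t" and x2: "x = \<beta> *\<^sub>R s' + (a + b - \<beta>) *\<^sub>R t'"
      unfolding D_def by (auto elim!: set_plus_elim)
    have "x = (1 - \<theta>) *\<^sub>R x + \<theta> *\<^sub>R x"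
      by (simp flip: scaleR_left_distrib)
    also have "\<dots> = (1 - \<theta>) *\<^sub>R (\<beta> *\<^sub>R s' + (a + b - \<beta>) *\<^sub>R t') + \<theta> *\<^sub>R (\<alpha> *\<^sub>R s + (a + b - \<alpha>) *\<^sub>R t)"
      using x1 x2 by metis
    also have "\<dots> = (((1 - \<theta>) * \<beta>) *\<^sub>R s' + (\<theta> * \<alpha>) *\<^sub>R s) +
        (((1 - \<theta>) * (a + b - \<beta>)) *\<^sub>R t' + (\<theta> * (a + b - \<alpha>)) *\<^sub>R t)"
      by (simp add: scaleR_right_distrib)
    finally have x: "x = \<dots>" .
    have "((1 - \<theta>) * \<beta>) *\<^sub>R s' + (\<theta> * \<alpha>) *\<^sub>R s \<in> (*\<^sub>R) ((1 - \<theta>) * \<beta>) ` A + (*\<^sub>R) (\<theta> * \<alpha>) ` A"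
      using st by blast
    also have "\<dots> = (*\<^sub>R) a ` A"
      unfolding a using \<theta> \<alpha> \<beta> assms by (intro convex_scaleR_plus) auto
    finally have A: "((1 - \<theta>) * \<beta>) *\<^sub>R s' + (\<theta> * \<alpha>) *\<^sub>R s \<in> (*\<^sub>R) a ` A" .
    have "((1 - \<theta>) * (a + b - \<beta>)) *\<^sub>R t' + (\<theta> * (a + b - \<alpha>)) *\<^sub>R t
        \<in> (*\<^sub>R) ((1 - \<theta>) * (a + b - \<beta>)) ` B + (*\<^sub>R) (\<theta> * (a + b - \<alpha>)) ` B"
      using st by blast
    also have "\<dots> = (*\<^sub>R) ((1 - \<theta>) * (a + b - \<beta>) + \<theta> * (a + b - \<alpha>)) ` B"
      using \<theta> \<alpha> \<beta> assms by (intro convex_scaleR_plus) auto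
    \<comment> \<open>Both representations have total weight a + b, so weight a on \<open>A\<close>
      leaves b on \<open>B\<close>.\<close>
    also have "(1 - \<theta>) * (a + b - \<beta>) + \<theta> * (a + b - \<alpha>) = a + b - ((1 - \<theta>) * \<beta> + \<theta> * \<alpha>)"
      by (simp add: algebra_simps)
    also have "\<dots> = a + b - a" using a by simp
    finally show "x \<in> D a"
      unfolding D_def x using A by blast
  qed
  moreover have "a \<in> {a..a + b}" "a \<in> {0..a}" using assms(5,6) by auto
  ultimately have "(\<Union>\<alpha>\<in>{a..a + b}. D \<alpha>) \<inter> (\<Union>\<beta>\<in>{0..a}. D \<beta>) = D a"
    by fastforce
  then show "((*\<^sub>R) a ` A + (*\<^sub>R) b ` C) \<inter> ((*\<^sub>R) a ` C + (*\<^sub>R) b ` B) = (*\<^sub>R) a ` A + (*\<^sub>R) b ` B"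
    unfolding upper lower by (simp add: D_def)
qed

lemma compact_scaleR_plus:
  fixes A B :: "'a::real_normed_vector set"
  assumes "compact A" "compact B"
  shows "compact ((*\<^sub>R) a ` A + (*\<^sub>R) b ` B)"
proof -
  have "compact {x + y |x y. x \<in> (*\<^sub>R) a ` A \<and> y \<in> (*\<^sub>R) b ` B}"
    using assms by (intro compact_sums compact_scaling)
  moreover have "{x + y |x y. x \<in> (*\<^sub>R) a ` A \<and> y \<in> (*\<^sub>R) b ` B} = (*\<^sub>R) a ` A + (*\<^sub>R) b ` B"
    by (auto simp: set_plus_def)
  ultimately show ?thesis by simp
qed

lemma convex_body_convex_hull_Un:
  assumes "convex_body A" "convex_body B"
  shows "convex_body (convex hull (A \<union> B))"
  using assms by (auto simp: convex_body_def intro: compact_convex_hull compact_Un)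

text \<open>Inclusion-exclusion for the two sets whose union and intersection were just computed;
  compactness makes their measures finite.\<close>

lemma measure_scaleR_hull_Un:
  assumes "convex_body A" "convex_body B" "a \<ge> 0" "b \<ge> 0"
  defines "C \<equiv> convex hull (A \<union> B)"
  shows "measure lebesgue ((*\<^sub>R) a ` C + (*\<^sub>R) b ` C) + measure lebesgue ((*\<^sub>R) a ` A + (*\<^sub>R) b ` B) =
    measure lebesgue ((*\<^sub>R) a ` A + (*\<^sub>R) b ` C) + measure lebesgue ((*\<^sub>R) a ` C + (*\<^sub>R) b ` B)"
proof -
  have AB: "convex A" "A \<noteq> {}" "convex B" "B \<noteq> {}" "compact A" "compact B"
    using assms by (auto simp: convex_body_def)
  have "compact C"
    using convex_body_convex_hull_Un[OF assms(1,2)] by (simp add: C_def convex_body_def)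
  then have "(*\<^sub>R) a ` A + (*\<^sub>R) b ` C \<in> lmeasurable" "(*\<^sub>R) a ` C + (*\<^sub>R) b ` B \<in> lmeasurable"
    using AB by (auto intro!: lmeasurable_compact compact_scaleR_plus)
  from measure_Un3[OF this] show ?thesis
    using scaleR_hull_Un_union[OF AB(1-4) assms(3,4)] scaleR_hull_Un_inter[OF AB(1-4) assms(3,4)]
    by (simp add: C_def)
qed

section \<open>Mixed volumes\<close>

text \<open>A permutation of the bodies permutes the index sets and keeps their cardinalities, hence
  the signs.\<close>

lemma mixed_volume_mset_cong:
  fixes As Bs :: "(real ^ 'n) set list"
  assumes "mset As = mset Bs" "length Bs = CARD('n)"
  shows "mixed_volume As = mixed_volume Bs"
proof -
  obtain p where p: "p permutes {..<length Bs}" and As: "permute_list p Bs = As"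
    using mset_eq_permutation[OF assms(1)] .
  have p': "p permutes {..<CARD('n)}" using p assms(2) by simp
  have inj: "inj p" using p permutes_inj by blast
  have "bij_betw ((`) p) (Pow {..<CARD('n)}) (Pow {..<CARD('n)})"
    using permutes_imp_bij[OF p'] by (rule bij_betw_Pow)
  then have bij: "bij_betw ((`) p) (Pow {..<CARD('n)} - {{}}) (Pow {..<CARD('n)} - {{}})"
    by (rule bij_betw_DiffI) (auto simp: bij_betw_def)
  have "(\<Sum>I \<in> Pow {..<CARD('n)} - {{}}.
          (-1) ^ (CARD('n) - card I) * measure lebesgue (\<Sum>i\<in>I. As ! i)) =
        (\<Sum>I \<in> Pow {..<CARD('n)} - {{}}.
          (-1) ^ (CARD('n) - card (p ` I)) * measure lebesgue (\<Sum>i\<in>p ` I. Bs ! i))"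
  proof (rule sum.cong[OF refl])
    fix I assume "I \<in> Pow {..<CARD('n)} - {{}}"
    then have "As ! i = Bs ! p i" if "i \<in> I" for i
      using that permute_list_nth[OF p, of i] assms(2) As by auto
    then have "(\<Sum>i\<in>I. As ! i) = (\<Sum>i\<in>p ` I. Bs ! i)"
      using inj by (subst sum.reindex) (auto simp: inj_on_def)
    moreover have "card (p ` I) = card I"
      using inj by (simp add: card_image inj_on_def)
    ultimately show "(-1) ^ (CARD('n) - card I) * measure lebesgue (\<Sum>i\<in>I. As ! i) =
        (-1) ^ (CARD('n) - card (p ` I)) * measure lebesgue (\<Sum>i\<in>p ` I. Bs ! i)"
      by simp
  qed
  also have "\<dots> = (\<Sum>I \<in> Pow {..<CARD('n)} - {{}}.
          (-1) ^ (CARD('n) - card I) * measure lebesgue (\<Sum>i\<in>I. Bs ! i))"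
    by (rule sum.reindex_bij_betw[OF bij])
  finally show ?thesis by (simp add: mixed_volume_def)
qed

text \<open>The two dilation factors depend only on \<open>I\<close> and \<open>k\<close>, not on
  the bodies. This allows different pairs of bodies to be compared term by term.\<close>

lemma sum_nth_replicate_append:
  fixes A B :: "'a::real_vector set"
  assumes "convex A" "A \<noteq> {}" "convex B" "B \<noteq> {}" "I \<subseteq> {..<k + m}"
  shows "(\<Sum>i\<in>I. (replicate k A @ replicate m B) ! i) =
    (*\<^sub>R) (real (card (I \<inter> {..<k}))) ` A + (*\<^sub>R) (real (card (I - {..<k}))) ` B"
proof -
  have fin: "finite I" using assms(5) finite_subset by blast
  have "(\<Sum>i\<in>I. (replicate k A @ replicate m B) ! i) =
      (\<Sum>i\<in>I \<inter> {..<k}. (replicate k A @ replicate m B) ! i) +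
      (\<Sum>i\<in>I - {..<k}. (replicate k A @ replicate m B) ! i)"
    using fin by (rule sum.Int_Diff)
  also have "(\<Sum>i\<in>I \<inter> {..<k}. (replicate k A @ replicate m B) ! i) = (\<Sum>i\<in>I \<inter> {..<k}. A)"
    by (rule sum.cong) (auto simp: nth_append)
  also have "(\<Sum>i\<in>I - {..<k}. (replicate k A @ replicate m B) ! i) = (\<Sum>i\<in>I - {..<k}. B)"
    using assms(5) by (intro sum.cong) (auto simp: nth_append)
  finally show ?thesis
    using assms fin by (simp add: sum_const_convex)
qed

text \<open>For each index set the four Minkowski sums share the same factors a and b, so the volume
  identity holds in every term of the signed sum.\<close>

lemma mixed_volume_hull_Un:
  fixes A B :: "(real ^ 'n) set"
  assumes "convex_body A" "convex_body B" "k + m = CARD('n)"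
  defines "C \<equiv> convex hull (A \<union> B)"
  shows "mixed_volume (replicate k C @ replicate m C) + mixed_volume (replicate k A @ replicate m B) =
    mixed_volume (replicate k A @ replicate m C) + mixed_volume (replicate k C @ replicate m B)"
proof -
  have "convex_body C"
    unfolding C_def using assms(1,2) by (rule convex_body_convex_hull_Un)
  then have ne: "convex A" "A \<noteq> {}" "convex B" "B \<noteq> {}" "convex C" "C \<noteq> {}"
    using assms(1,2) by (auto simp: convex_body_def)
  have "measure lebesgue (\<Sum>i\<in>I. (replicate k C @ replicate m C) ! i) +
      measure lebesgue (\<Sum>i\<in>I. (replicate k A @ replicate m B) ! i) =
      measure lebesgue (\<Sum>i\<in>I. (replicate k A @ replicate m C) ! i) +
      measure lebesgue (\<Sum>i\<in>I. (replicate k C @ replicate m B) ! i)"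
    if "I \<in> Pow {..<CARD('n)} - {{}}" for I
  proof -
    have "I \<subseteq> {..<k + m}" using that assms(3) by auto
    then show ?thesis
      using measure_scaleR_hull_Un[OF assms(1,2), of "card (I \<inter> {..<k})" "card (I - {..<k})"] ne
      by (simp add: sum_nth_replicate_append C_def)
  qed
  then show ?thesis
    unfolding mixed_volume_def distrib_left[symmetric] sum.distrib[symmetric]
    by (intro arg_cong[where f = "(*) _"] sum.cong refl) simp
qed

section \<open>Evaluation of polynomials\<close>

text \<open>Monomials that cancel in \<open>p + q\<close> drop out of its keys, but they would
  contribute 0 anyway.\<close>

lemma mixed_eval_add: "mixed_eval (p + q) S0 S1 S2 = mixed_eval p S0 S1 S2 + mixed_eval q S0 S1 S2"
  unfolding mixed_eval_def by (rule setsum_keys_plus_distrib) (simp_all add: distrib_right)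

lemma mixed_eval_diff: "mixed_eval (p - q) S0 S1 S2 = mixed_eval p S0 S1 S2 - mixed_eval q S0 S1 S2"
  using mixed_eval_add[of "p - q" q S0 S1 S2] by simp

lemma mixed_eval_sum: "mixed_eval (\<Sum>i\<in>I. f i) S0 S1 S2 = (\<Sum>i\<in>I. mixed_eval (f i) S0 S1 S2)"
proof (induction I rule: infinite_finite_induct)
  case empty
  then show ?case by (simp add: mixed_eval_def)
next
  case (infinite I)
  then show ?case by (simp add: mixed_eval_def)
qed (simp add: mixed_eval_add)

lemma mixed_eval_single:
  "mixed_eval (Poly_Mapping.single m c) S0 S1 S2 =
    c * mixed_volume (replicate (Poly_Mapping.lookup m X0) S0 @
                      replicate (Poly_Mapping.lookup m X1) S1 @
                      replicate (Poly_Mapping.lookup m X2) S2)"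
  by (simp add: mixed_eval_def)

text \<open>Constants become monomials with exponent vector 0, so that each product in
  \<open>R\<close> collapses to a single monomial.\<close>

lemma const_poly_eq_single:
  "(2 :: poly3) = Poly_Mapping.single 0 2"
  "(2 ^ n - 2 :: poly3) = Poly_Mapping.single 0 (2 ^ n - 2)"
proof -
  have "(2 :: poly3) ^ n = Poly_Mapping.single 0 (2 ^ n)"
    by (induction n) (simp_all add: mult_single flip: single_numeral)
  then show "(2 ^ n - 2 :: poly3) = Poly_Mapping.single 0 (2 ^ n - 2)"
    by (simp add: single_diff)
qed simp

lemma single_power:
  "Poly_Mapping.single (Poly_Mapping.single v j) (c :: real) ^ k =
    Poly_Mapping.single (Poly_Mapping.single v (k * j)) (c ^ k)"
  by (induction k) (simp_all add: mult_single flip: single_add)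

lemma two_Var: "2 * Var v = Poly_Mapping.single (Poly_Mapping.single v 1) 2"
  by (simp add: Var_def const_poly_eq_single mult_single del: single_numeral)

theorem proposition1:
  fixes S0 S1 S2 :: "(real ^ 'n) set"
  assumes "convex_body S1" and "convex_body S2"
    and "S0 = convex hull (S1 \<union> S2)"
  shows "mixed_eval (R CARD('n)) S0 S1 S2 = 0"
proof -
  let ?n = "CARD('n)"
  define V where "V k A B = mixed_volume (replicate k A @ replicate (?n - k) B)"
    for k and A B :: "(real ^ 'n) set"
  have V00: "V k S0 S0 = mixed_volume (replicate ?n S0)" if "k \<le> ?n" for k
    using that by (simp add: V_def flip: replicate_add)
  \<comment> \<open>\<open>mixed_eval\<close> lists \<open>S0\<close> before \<open>S1\<close>,
    whereas the relation below has \<open>S1\<close> first.\<close>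
  have V10: "mixed_volume (replicate (?n - k) S0 @ replicate k S1) = V k S1 S0" if "k \<le> ?n" for k
    unfolding V_def using that by (intro mixed_volume_mset_cong) simp_all
  have rel: "V k S0 S0 + V k S1 S2 = V k S1 S0 + V k S0 S2" if "k \<le> ?n" for k
    unfolding V_def assms(3) using that assms by (intro mixed_volume_hull_Un) auto
  have e12: "mixed_eval (Q2 ?n (Var X1) (2 * Var X2)) S0 S1 S2 =
      (\<Sum>i = 1..?n - 1. 2 ^ (?n - i) * V i S1 S2)"
    unfolding Q2_def mixed_eval_sum two_Var unfolding Var_def
    by (simp add: single_power mult_single mixed_eval_single lookup_add lookup_single V_def)
  have e02: "mixed_eval (Q2 ?n (Var X0) (2 * Var X2)) S0 S1 S2 =
      (\<Sum>i = 1..?n - 1. 2 ^ (?n - i) * V i S0 S2)"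
    unfolding Q2_def mixed_eval_sum two_Var unfolding Var_def
    by (simp add: single_power mult_single mixed_eval_single lookup_add lookup_single V_def)
  have "mixed_eval (Q2 ?n (2 * Var X0) (Var X1)) S0 S1 S2 =
      (\<Sum>i = 1..?n - 1. 2 ^ i * mixed_volume (replicate i S0 @ replicate (?n - i) S1))"
    unfolding Q2_def mixed_eval_sum two_Var unfolding Var_def
    by (simp add: single_power mult_single mixed_eval_single lookup_add lookup_single)
  \<comment> \<open>Here the factor 2 sits on the first variable; the reflection i to n - i gives
    the weights of the other sums.\<close>
  also have "\<dots> = (\<Sum>i = 1..?n - 1. 2 ^ (?n - i) * V i S1 S0)"
    by (rule sum.reindex_bij_witness[of _ "\<lambda>i. ?n - i" "\<lambda>i. ?n - i"]) (auto simp flip: V10)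
  finally have e01: "mixed_eval (Q2 ?n (2 * Var X0) (Var X1)) S0 S1 S2 =
      (\<Sum>i = 1..?n - 1. 2 ^ (?n - i) * V i S1 S0)" .
  \<comment> \<open>The coefficient 2^n - 2 is the total of the weights, so the pure power of
    \<open>S0\<close> can be spread over the same sum as the terms \<open>V i S0 S0\<close>. For n =
    1 both are 0.\<close>
  have "(\<Sum>i = 1..?n - 1. 2 ^ (?n - i)) = (\<Sum>i = 1..?n - 1. 2 ^ i :: real)"
    by (rule sum.reindex_bij_witness[of _ "\<lambda>i. ?n - i" "\<lambda>i. ?n - i"]) auto
  also have "\<dots> = 2 ^ ?n - 2"
  proof -
    have "(\<Sum>i = 1..n. 2 ^ i :: real) = 2 ^ Suc n - 2" for n
      by (induction n) simp_all
    from this[of "?n - 1"] show ?thesis by simp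
  qed
  finally have geom: "(\<Sum>i = 1..?n - 1. 2 ^ (?n - i)) = (2 ^ ?n - 2 :: real)" .
  have "mixed_eval ((2 ^ ?n - 2) * Var X0 ^ ?n) S0 S1 S2 = (2 ^ ?n - 2) * mixed_volume (replicate ?n S0)"
    unfolding const_poly_eq_single(2) Var_def
    by (simp add: single_power mult_single mixed_eval_single lookup_single)
  also have "\<dots> = (\<Sum>i = 1..?n - 1. 2 ^ (?n - i) * V i S0 S0)"
    unfolding geom[symmetric] sum_distrib_right by (intro sum.cong) (auto simp: V00)
  finally have e00: "mixed_eval ((2 ^ ?n - 2) * Var X0 ^ ?n) S0 S1 S2 =
      (\<Sum>i = 1..?n - 1. 2 ^ (?n - i) * V i S0 S0)" .
  \<comment> \<open>With equal weights everywhere, the four sums merge and \<open>rel\<close>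
    annihilates each term.\<close>
  have "mixed_eval (R ?n) S0 S1 S2 =
      (\<Sum>i = 1..?n - 1. 2 ^ (?n - i) * (V i S0 S0 + V i S1 S2 - V i S1 S0 - V i S0 S2))"
    unfolding R_def Let_def mixed_eval_diff mixed_eval_add e00 e12 e01 e02
    by (simp add: sum.distrib sum_subtractf algebra_simps)
  also have "\<dots> = 0"
    by (rule sum.neutral) (auto simp: rel)
  finally show ?thesis .
qed

end
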